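(* Let $n\ge 1$, let $\tau$ be a locally convex topology on the real vector space $\mathbb{R}[\underline{X}]=\mathbb{R}[X_1,\ldots,X_n]$, let $K\subseteq\mathbb{R}^n$ be a closed subset, and let $C\subseteq\mathbb{R}[\underline{X}]$ be a cone. The following are equivalent: (1) $C_{\tau}^{\vee}\subseteq \mathrm{Psd}(K)_{\tau}^{\vee}$; (2) $\mathrm{Psd}(K)\subseteq C_{\tau}^{\vee\vee}$; (3) for every $\ell\in C_{\tau}^{\vee}$ there exists a positive Borel measure $\mu$ on $K$ such that $\ell(f)=\int_K f\,d\mu$ for all $f\in\mathbb{R}[\underline{X}]$.
   Context: A vector space topology on a real vector space $V$ is a topology in which every point is closed and for which vector addition and scalar multiplication are continuous. A locally convex topology is a vector space topology admitting a neighbourhood basis of convex open sets at each point. A subset $C\subseteq V$ is a cone if $C+C\subseteq C$ and $\mathbb{R}^+C\subseteq C$. For a closed (or arbitrary) $K\subseteq\mathbb{R}^n$, $\mathrm{Psd}(K)=\{f\in\mathbb{R}[\underline{X}] : f(x)\ge 0 \text{ for all } x\in K\}$. For $V=\mathbb{R}[\underline{X}]$ with topology $\tau$, let $V^*$ be the set of all $\tau$-continuous linear functionals $V\to\mathbb{R}$. For $C\subseteq V$, $C_\tau^\vee=\{\ell\in V^* : \ell\ge 0 \text{ on } C\}$ and $C_\tau^{\vee\vee}=\{a\in V : \ell(a)\ge 0 \text{ for all } \ell\in C_\tau^\vee\}$. Representation of $\ell$ by a measure $\mu$ includes that all polynomials are $\mu$-integrable. *)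

theory Defs
  imports "HOL-Analysis.Analysis" "HOL-Analysis.Finite_Function_Topology"
begin

text \<open>Exponent vectors are maps from the finite index type of the variables to nat, so that
  \<open>'n mpoly\<close> is the monoid algebra of \<open>\<nat>\<^sup>n\<close> over the reals, with \<open>n = CARD('n) \<ge> 1\<close>.\<close>

type_synonym 'n mpoly = "('n \<Rightarrow>\<^sub>0 nat) \<Rightarrow>\<^sub>0 real"

definition poly_eval :: "'n::finite mpoly \<Rightarrow> real^'n \<Rightarrow> real" where
  "poly_eval f x =
     (\<Sum>m\<in>Poly_Mapping.keys f.
        Poly_Mapping.lookup f m * (\<Prod>i\<in>UNIV. (x $ i) ^ Poly_Mapping.lookup m i))"

definition Psd :: "(real^'n) set \<Rightarrow> 'n::finite mpoly set" where
  "Psd K = {f. \<forall>x\<in>K. poly_eval f x \<ge> 0}"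

text \<open>The topologies below are values of type \<open>'v topology\<close>. They are unrelated to the metric
  topology that the type class instances put on \<open>poly_mapping\<close>.\<close>

definition vector_space_topology :: "'v::real_vector topology \<Rightarrow> bool" where
  "vector_space_topology \<tau> \<longleftrightarrow>
     topspace \<tau> = UNIV \<and>
     (\<forall>v. closedin \<tau> {v}) \<and>
     continuous_map (prod_topology \<tau> \<tau>) \<tau> (\<lambda>(v, w). v + w) \<and>
     continuous_map (prod_topology euclideanreal \<tau>) \<tau> (\<lambda>(r, v). r *\<^sub>R v)"

definition locally_convex_topology :: "'v::real_vector topology \<Rightarrow> bool" where
  "locally_convex_topology \<tau> \<longleftrightarrow>
     vector_space_topology \<tau> \<and>
     (\<forall>v U. openin \<tau> U \<and> v \<in> U \<longrightarrow> (\<exists>W. openin \<tau> W \<and> convex W \<and> v \<in> W \<and> W \<subseteq> U))"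

text \<open>Only strictly positive scalars are required to preserve the set. Allowing the scalar 0 as
  well would give a more restrictive notion. The predicates \<open>conic\<close> and \<open>convex_cone\<close> of
  the library additionally require closure under multiplication by 0.\<close>

definition is_cone :: "'v::real_vector set \<Rightarrow> bool" where
  "is_cone C \<longleftrightarrow> (\<forall>v\<in>C. \<forall>w\<in>C. v + w \<in> C) \<and> (\<forall>r>0. \<forall>v\<in>C. r *\<^sub>R v \<in> C)"

definition cont_dual :: "'v::real_vector topology \<Rightarrow> ('v \<Rightarrow> real) set" where
  "cont_dual \<tau> = {l. linear l \<and> continuous_map \<tau> euclideanreal l}"

definition dual_cone :: "'v::real_vector topology \<Rightarrow> 'v set \<Rightarrow> ('v \<Rightarrow> real) set" where
  "dual_cone \<tau> C = {l \<in> cont_dual \<tau>. \<forall>v\<in>C. l v \<ge> 0}"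

definition bidual_cone :: "'v::real_vector topology \<Rightarrow> 'v set \<Rightarrow> 'v set" where
  "bidual_cone \<tau> C = {v. \<forall>l \<in> dual_cone \<tau> C. l v \<ge> 0}"

text \<open>The measure lives on \<open>K\<close> itself, with the Borel sigma-algebra of the subspace \<open>K\<close>.
  Integrability is stated explicitly because the Bochner integral of a non-integrable
  function is 0.\<close>

definition represented_by_measure_on ::
    "(real^'n) set \<Rightarrow> ('n::finite mpoly \<Rightarrow> real) \<Rightarrow> (real^'n) measure \<Rightarrow> bool" where
  "represented_by_measure_on K l \<mu> \<longleftrightarrow>
     sets \<mu> = sets (restrict_space borel K) \<and>
     (\<forall>f. integrable \<mu> (poly_eval f) \<and> l f = (\<integral>x. poly_eval f x \<partial>\<mu>))"

end

theory Submission
  imports Defs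
begin

text \<open>
  Both (1) and (2) say that \<open>l f \<ge> 0\<close> for every \<open>l\<close> in the dual cone of \<open>C\<close> and every \<open>f\<close> in
  \<open>Psd K\<close>; they differ in the order of the two quantifiers. A functional represented by a
  measure on \<open>K\<close> is nonnegative on \<open>Psd K\<close>, because the integral of a nonnegative function is
  nonnegative. What remains is Haviland's theorem (\<open>haviland\<close>): a linear functional \<open>l\<close> that is
  nonnegative on \<open>Psd K\<close> is integration against a measure on \<open>K\<close>.

  The functional is first extended to all functions dominated by a polynomial
  (\<open>psd_functional_extension\<close>). The infimum of \<open>l q\<close> over the polynomials \<open>q\<close> that majorise
  \<open>f\<close> on \<open>K\<close> is sublinear in \<open>f\<close>, and by Hahn-Banach there is a linear functional \<open>L\<close> below it
  (\<open>linear_minorant_exists\<close>). Such an \<open>L\<close> agrees with \<open>l\<close> on polynomials and is positive with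
  respect to \<open>K\<close>.

  In particular \<open>L\<close> is defined on indicators of sets, but it is only finitely additive there: mass
  may sit infinitely close to a point, or at infinity. A genuine measure is obtained
  from the masses \<open>L\<close> assigns to dyadic cubes (\<open>riesz_representation_bounded\<close>). The tree of
  dyadic cubes is copied to the real line as a tree of nested half-open intervals, the
  length of an interval being the mass of its cube (\<open>nested_interval_realization\<close>). A point of
  the line selects a nested sequence of cubes of positive mass, which shrinks to a point of
  the closed set \<open>K\<close>; the image of Lebesgue measure under this map is \<open>\<mu>\<close>. Lebesgue measure
  supplies the countable additivity. By uniform continuity, integration against \<open>\<mu>\<close> and \<open>L\<close> agree
  on continuous functions of compact support, since both are limits of the same sums over cubes.

  Finally, the two agree on polynomials. For a nonnegative polynomial \<open>q\<close> and a continuous cutoff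
  \<open>\<chi>\<close> that is \<open>1\<close> on the ball of radius \<open>N\<close>, the error \<open>L (q - \<chi> q)\<close> is at most
  \<open>l (q (|x|\<^sup>2 + 1)) / (N + 1)\<close>; it tends to \<open>0\<close>, because \<open>q (|x|\<^sup>2 + 1)\<close> is a polynomial
  as well, so no mass of \<open>q\<close> is lost at infinity. Monotone convergence then gives
  integrability of \<open>q\<close> and \<open>\<integral> q d\<mu> = l q\<close>. Every polynomial is a
  difference of two nonnegative ones.
\<close>

section \<open>Linear functionals below a sublinear one\<close>

text \<open>Spaces of real functions are sets closed under the pointwise operations. The space that
  matters below, the functions dominated by a polynomial, is a proper subset of its function type.\<close>

definition function_space :: "('a \<Rightarrow> real) set \<Rightarrow> bool" where
  "function_space V \<longleftrightarrow>
     (\<forall>f\<in>V. \<forall>g\<in>V. (\<lambda>x. f x + g x) \<in> V) \<and> (\<forall>f\<in>V. \<forall>c. (\<lambda>x. c * f x) \<in> V)"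

text \<open>Homogeneity is demanded only as an inequality for \<open>c > 0\<close>; replacing \<open>c\<close> by \<open>1 / c\<close> gives
  the reverse inequality.\<close>

definition sublinear_on :: "('a \<Rightarrow> real) set \<Rightarrow> (('a \<Rightarrow> real) \<Rightarrow> real) \<Rightarrow> bool" where
  "sublinear_on V p \<longleftrightarrow>
     (\<forall>f\<in>V. \<forall>g\<in>V. p (\<lambda>x. f x + g x) \<le> p f + p g) \<and>
     (\<forall>f\<in>V. \<forall>c>0. p (\<lambda>x. c * f x) \<le> c * p f)"

definition linear_functional_on :: "('a \<Rightarrow> real) set \<Rightarrow> (('a \<Rightarrow> real) \<Rightarrow> real) \<Rightarrow> bool" where
  "linear_functional_on V L \<longleftrightarrow>
     (\<forall>f\<in>V. \<forall>g\<in>V. L (\<lambda>x. f x + g x) = L f + L g) \<and>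
     (\<forall>f\<in>V. \<forall>c. L (\<lambda>x. c * f x) = c * L f)"

lemma function_space_add: "function_space V \<Longrightarrow> f \<in> V \<Longrightarrow> g \<in> V \<Longrightarrow> (\<lambda>x. f x + g x) \<in> V"
  by (simp add: function_space_def)

lemma function_space_scale: "function_space V \<Longrightarrow> f \<in> V \<Longrightarrow> (\<lambda>x. c * f x) \<in> V"
  by (simp add: function_space_def)

lemma function_space_uminus: "function_space V \<Longrightarrow> f \<in> V \<Longrightarrow> (\<lambda>x. - f x) \<in> V"
  using function_space_scale[of V f "-1"] by simp

lemma sublinear_on_add:
  "sublinear_on V p \<Longrightarrow> f \<in> V \<Longrightarrow> g \<in> V \<Longrightarrow> p (\<lambda>x. f x + g x) \<le> p f + p g"
  by (simp add: sublinear_on_def)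

lemma sublinear_on_scale:
  "sublinear_on V p \<Longrightarrow> f \<in> V \<Longrightarrow> c > 0 \<Longrightarrow> p (\<lambda>x. c * f x) \<le> c * p f"
  by (simp add: sublinear_on_def)

lemma sublinear_on_zero:
  assumes V: "function_space V" and p: "sublinear_on V p" and f: "f \<in> V"
  shows "p (\<lambda>x. 0) = 0"
proof -
  have z: "(\<lambda>x. 0) \<in> V"
    using function_space_scale[OF V f, of 0] by simp
  show ?thesis
    using sublinear_on_scale[OF p z, of 2] sublinear_on_scale[OF p z, of "1/2"] by simp
qed

text \<open>This lower bound along translates keeps the infimum in the proof of the Hahn-Banach theorem
  below finite.\<close>

lemma sublinear_on_lower:
  assumes V: "function_space V" and p: "sublinear_on V p" and f: "f \<in> V" and g: "g \<in> V"
  shows "p f \<le> p (\<lambda>x. f x + g x) + p (\<lambda>x. - g x)"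
  using sublinear_on_add[OF p function_space_add[OF V f g] function_space_uminus[OF V g]] by simp

text \<open>Zorn's lemma applies because the infimum of a chain of sublinear functionals is again
  sublinear: for two members of the chain, the smaller one bounds both summands at once.
  The infimum is finite since every member below \<open>p\<close> satisfies \<open>q f \<ge> - p (- f)\<close>.\<close>

lemma minimal_sublinear_minorant:
  assumes V: "function_space V" and p: "sublinear_on V p"
  obtains q where "sublinear_on V q" "\<And>f. f \<in> V \<Longrightarrow> q f \<le> p f"
    "\<And>r f. sublinear_on V r \<Longrightarrow> (\<And>f. f \<in> V \<Longrightarrow> r f \<le> q f) \<Longrightarrow> f \<in> V \<Longrightarrow> r f = q f"
proof -
  \<comment> \<open>Functionals are set to 0 off \<open>V\<close>, so that the pointwise order is antisymmetric.\<close>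
  define A where "A = {q. sublinear_on V q \<and> (\<forall>f\<in>V. q f \<le> p f) \<and> (\<forall>f. f \<notin> V \<longrightarrow> q f = 0)}"
  define P where "P q r \<longleftrightarrow> (\<forall>f. r f \<le> q f)" for q r :: "('a \<Rightarrow> real) \<Rightarrow> real"
  note Vadd = function_space_add[OF V] and Vscale = function_space_scale[OF V]
    and Vneg = function_space_uminus[OF V]
  have restrict: "(\<lambda>f. if f \<in> V then q f else 0) \<in> A"
    if "sublinear_on V q" "\<And>f. f \<in> V \<Longrightarrow> q f \<le> p f" for q
    using that Vadd Vscale by (simp add: A_def sublinear_on_def)
  have bound: "- p (\<lambda>x. - f x) \<le> q f" if "q \<in> A" "f \<in> V" for q f
  proof -
    have q: "sublinear_on V q" "q (\<lambda>x. - f x) \<le> p (\<lambda>x. - f x)"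
      using that Vneg by (auto simp: A_def)
    have "q (\<lambda>x. f x + - f x) \<le> q f + q (\<lambda>x. - f x)"
      by (rule sublinear_on_add[OF q(1) that(2) Vneg[OF that(2)]])
    then show ?thesis
      using sublinear_on_zero[OF V q(1) that(2)] q(2) by simp
  qed
  have "\<exists>m\<in>A. \<forall>a\<in>A. P m a \<longrightarrow> a = m"
  proof (rule predicate_Zorn)
    show "partial_order_on A (relation_of P A)"
    proof -
      have "P f f" for f by (simp add: P_def)
      moreover have "P f h" if "P f g" "P g h" for f g h
        using that unfolding P_def by (meson order.trans)
      moreover have "f = g" if "P f g" "P g f" for f g
        using that unfolding P_def by (intro ext order.antisym) auto
      ultimately show ?thesis
        unfolding partial_order_on_def preorder_on_def refl_on_def trans_def antisym_def relation_of_def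
        by blast
    qed
  next
    fix C assume C: "C \<in> Chains (relation_of P A)"
    have CA: "C \<subseteq> A" and total: "\<And>q r. q \<in> C \<Longrightarrow> r \<in> C \<Longrightarrow> P q r \<or> P r q"
      using C by (auto simp: Chains_def relation_of_def)
    show "\<exists>u\<in>A. \<forall>a\<in>C. P a u"
    proof (cases "C = {}")
      case True
      then show ?thesis using restrict[OF p] by auto
    next
      case False
      define u where "u f = (INF q\<in>C. q f)" for f
      have bdd: "bdd_below ((\<lambda>q. q f) ` C)" if "f \<in> V" for f
        using bound[OF _ that] CA by (intro bdd_belowI2[of _ "- p (\<lambda>x. - f x)"]) auto
      have u_le: "u f \<le> q f" if "f \<in> V" "q \<in> C" for f q
        unfolding u_def using bdd[OF that(1)] that(2) by (intro cINF_lower)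
      have "sublinear_on V u"
        unfolding sublinear_on_def
      proof (intro conjI ballI allI impI)
        fix f g assume fg: "f \<in> V" "g \<in> V"
        have *: "u (\<lambda>x. f x + g x) \<le> q f + r g" if qr: "q \<in> C" "r \<in> C" for q r
        proof -
          obtain s where s: "s \<in> C" "s f \<le> q f" "s g \<le> r g"
            using total[OF qr] qr unfolding P_def by blast
          have "u (\<lambda>x. f x + g x) \<le> s (\<lambda>x. f x + g x)" using u_le Vadd fg s by blast
          also have "\<dots> \<le> s f + s g" using s CA fg by (auto simp: A_def sublinear_on_def)
          finally show ?thesis using s by linarith
        qed
        have "u (\<lambda>x. f x + g x) - r g \<le> u f" if "r \<in> C" for r
          unfolding u_def[of f] using False *[OF _ that] by (intro cINF_greatest) (auto simp: algebra_simps)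
        then have "u (\<lambda>x. f x + g x) - u f \<le> u g"
          unfolding u_def[of g] using False by (intro cINF_greatest) (auto simp: algebra_simps)
        then show "u (\<lambda>x. f x + g x) \<le> u f + u g" by linarith
      next
        fix f and c :: real assume f: "f \<in> V" and c: "0 < c"
        have "u (\<lambda>x. c * f x) / c \<le> q f" if "q \<in> C" for q
        proof -
          have "u (\<lambda>x. c * f x) \<le> q (\<lambda>x. c * f x)" using u_le Vscale f that by blast
          also have "\<dots> \<le> c * q f" using that CA f c by (auto simp: A_def sublinear_on_def)
          finally show ?thesis using c by (simp add: field_simps)
        qed
        then have "u (\<lambda>x. c * f x) / c \<le> u f"
          unfolding u_def[of f] using False by (intro cINF_greatest) auto
        then show "u (\<lambda>x. c * f x) \<le> c * u f" using c by (simp add: field_simps)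
      qed
      moreover have "u f \<le> p f" if "f \<in> V" for f
      proof -
        obtain q where "q \<in> C" using False by blast
        then show ?thesis using u_le[OF that] CA that by (force simp: A_def)
      qed
      ultimately have "(\<lambda>f. if f \<in> V then u f else 0) \<in> A" by (rule restrict)
      moreover have "P q (\<lambda>f. if f \<in> V then u f else 0)" if "q \<in> C" for q
        using u_le[OF _ that] subsetD[OF CA that] unfolding P_def by (simp add: A_def)
      ultimately show ?thesis by blast
    qed
  qed
  then obtain q where q: "q \<in> A" and min: "\<And>r. r \<in> A \<Longrightarrow> P q r \<Longrightarrow> r = q" by metis
  show thesis
  proof (rule that[of q])
    fix r f assume r: "sublinear_on V r" "\<And>f. f \<in> V \<Longrightarrow> r f \<le> q f" and f: "f \<in> V"
    have "(\<lambda>f. if f \<in> V then r f else 0) \<in> A"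
    proof (rule restrict[OF r(1)])
      fix g assume g: "g \<in> V"
      have "q g \<le> p g" using q g by (simp add: A_def)
      then show "r g \<le> p g" using r(2)[OF g] by linarith
    qed
    moreover have "P q (\<lambda>f. if f \<in> V then r f else 0)"
      using q r(2) unfolding P_def by (simp add: A_def)
    ultimately have "(\<lambda>f. if f \<in> V then r f else 0) = q" by (rule min)
    from fun_cong[OF this, of f] show "r f = q f" using f by simp
  qed (use q in \<open>auto simp: A_def\<close>)
qed

text \<open>The Hahn-Banach theorem. A minimal sublinear functional \<open>q\<close> is already linear: for fixed
  \<open>g\<close>, the functional \<open>r f = inf {q (f + t g) - t q g | t \<ge> 0}\<close> is sublinear and below \<open>q\<close>, hence
  equal to \<open>q\<close>, and its competitor at \<open>t = 1\<close> yields \<open>q f + q g \<le> q (f + g)\<close>.\<close>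

lemma linear_minorant_exists:
  assumes V: "function_space V" and p: "sublinear_on V p"
  obtains L where "linear_functional_on V L" "\<And>f. f \<in> V \<Longrightarrow> L f \<le> p f"
proof -
  obtain q where q: "sublinear_on V q" "\<And>f. f \<in> V \<Longrightarrow> q f \<le> p f"
    and min: "\<And>r f. sublinear_on V r \<Longrightarrow> (\<And>f. f \<in> V \<Longrightarrow> r f \<le> q f) \<Longrightarrow> f \<in> V \<Longrightarrow> r f = q f"
    using minimal_sublinear_minorant[OF V p] by blast
  note Vadd = function_space_add[OF V] and Vscale = function_space_scale[OF V]
    and Vneg = function_space_uminus[OF V]
  note qadd = sublinear_on_add[OF q(1)] and qscale = sublinear_on_scale[OF q(1)]
  have qzero: "q (\<lambda>x. 0) = 0" if "f \<in> V" for f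
    using sublinear_on_zero[OF V q(1) that] .
  have super: "q f + q g \<le> q (\<lambda>x. f x + g x)" if f: "f \<in> V" and g: "g \<in> V" for f g
  proof -
    define r where "r f = (INF t\<in>{0..}. q (\<lambda>x. f x + t * g x) - t * q g)" for f
    have lower: "- q (\<lambda>x. - f x) \<le> q (\<lambda>x. f x + t * g x) - t * q g" if "f \<in> V" "0 \<le> t" for f t
    proof -
      have "t * q g \<le> q (\<lambda>x. t * g x)"
      proof (cases "t = 0")
        case True
        then show ?thesis using qzero[OF g] by simp
      next
        case False
        then have "q (\<lambda>x. 1/t * (t * g x)) \<le> 1/t * q (\<lambda>x. t * g x)"
          using that by (intro qscale Vscale g) auto
        then show ?thesis using False that by (simp add: field_simps)
      qed
      also have "\<dots> \<le> q (\<lambda>x. f x + t * g x) + q (\<lambda>x. - f x)"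
        using sublinear_on_lower[OF V q(1) Vscale[OF g] that(1), of t] by (simp add: add.commute)
      finally show ?thesis by linarith
    qed
    have bdd: "bdd_below ((\<lambda>t. q (\<lambda>x. f x + t * g x) - t * q g) ` {0..})" if "f \<in> V" for f
      using lower[OF that] by (intro bdd_belowI2[of _ "- q (\<lambda>x. - f x)"]) auto
    have r_le: "r f \<le> q (\<lambda>x. f x + t * g x) - t * q g" if "f \<in> V" "0 \<le> t" for f t
      unfolding r_def using bdd[OF that(1)] that(2) by (intro cINF_lower) auto
    have "sublinear_on V r"
      unfolding sublinear_on_def
    proof (intro conjI ballI allI impI)
      fix f h assume fh: "f \<in> V" "h \<in> V"
      have *: "r (\<lambda>x. f x + h x) \<le>
          (q (\<lambda>x. f x + s * g x) - s * q g) + (q (\<lambda>x. h x + t * g x) - t * q g)"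
        if "0 \<le> s" "0 \<le> t" for s t
      proof -
        have "r (\<lambda>x. f x + h x) \<le> q (\<lambda>x. f x + h x + (s + t) * g x) - (s + t) * q g"
          using that fh by (intro r_le Vadd) auto
        also have "q (\<lambda>x. f x + h x + (s + t) * g x) =
            q (\<lambda>x. (f x + s * g x) + (h x + t * g x))"
          by (simp add: algebra_simps)
        also have "\<dots> \<le> q (\<lambda>x. f x + s * g x) + q (\<lambda>x. h x + t * g x)"
          by (intro qadd Vadd Vscale fh g)
        finally show ?thesis by (simp add: algebra_simps)
      qed
      have "r (\<lambda>x. f x + h x) - (q (\<lambda>x. h x + t * g x) - t * q g) \<le> r f" if "0 \<le> t" for t
        unfolding r_def[of f] using *[OF _ that] by (intro cINF_greatest) (auto simp: algebra_simps)
      then have "r (\<lambda>x. f x + h x) - r f \<le> r h"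
        unfolding r_def[of h] by (intro cINF_greatest) (auto simp: algebra_simps)
      then show "r (\<lambda>x. f x + h x) \<le> r f + r h" by linarith
    next
      fix f and c :: real assume f: "f \<in> V" and c: "0 < c"
      have "r (\<lambda>x. c * f x) / c \<le> q (\<lambda>x. f x + t * g x) - t * q g" if "0 \<le> t" for t
      proof -
        have "r (\<lambda>x. c * f x) \<le> q (\<lambda>x. c * f x + (c * t) * g x) - (c * t) * q g"
          using that c f by (intro r_le Vscale) auto
        also have "q (\<lambda>x. c * f x + (c * t) * g x) = q (\<lambda>x. c * (f x + t * g x))"
          by (simp add: algebra_simps)
        also have "\<dots> \<le> c * q (\<lambda>x. f x + t * g x)"
          by (intro qscale Vadd Vscale f g c)
        finally show ?thesis using c by (simp add: field_simps)
      qed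
      then have "r (\<lambda>x. c * f x) / c \<le> r f"
        unfolding r_def[of f] by (intro cINF_greatest) auto
      then show "r (\<lambda>x. c * f x) \<le> c * r f" using c by (simp add: field_simps)
    qed
    moreover have "r f \<le> q f" if "f \<in> V" for f
      using r_le[OF that, of 0] by simp
    ultimately have "r f = q f" using f by (intro min)
    then show ?thesis using r_le[OF f, of 1] by simp
  qed
  have add: "q (\<lambda>x. f x + g x) = q f + q g" if "f \<in> V" "g \<in> V" for f g
    using super[OF that] qadd[OF that] by linarith
  have neg: "q (\<lambda>x. - f x) = - q f" if "f \<in> V" for f
    using add[OF that Vneg[OF that]] qzero[OF that] by simp
  have pos: "q (\<lambda>x. c * f x) = c * q f" if "f \<in> V" "c > 0" for f c
  proof -
    have "q (\<lambda>x. 1/c * (c * f x)) \<le> 1/c * q (\<lambda>x. c * f x)"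
      using that by (intro qscale Vscale) auto
    then have "c * q f \<le> q (\<lambda>x. c * f x)" using that by (simp add: field_simps)
    then show ?thesis using qscale[OF that] by linarith
  qed
  have "q (\<lambda>x. c * f x) = c * q f" if f: "f \<in> V" for f c
  proof (cases c "0::real" rule: linorder_cases)
    case less
    then show ?thesis using pos[OF Vneg[OF f], of "-c"] neg[OF f] by simp
  next
    case equal
    then show ?thesis using qzero[OF f] by simp
  next
    case greater
    then show ?thesis using pos[OF f] by simp
  qed
  then have "linear_functional_on V q" using add by (auto simp: linear_functional_on_def)
  then show thesis using q(2) that by blast
qed

section \<open>Positive functionals\<close>

definition positive_functional_on ::
    "('a \<Rightarrow> real) set \<Rightarrow> 'a set \<Rightarrow> (('a \<Rightarrow> real) \<Rightarrow> real) \<Rightarrow> bool" where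
  "positive_functional_on V K L \<longleftrightarrow> (\<forall>f\<in>V. (\<forall>x\<in>K. 0 \<le> f x) \<longrightarrow> 0 \<le> L f)"

lemma linear_functional_on_add:
  "linear_functional_on V L \<Longrightarrow> f \<in> V \<Longrightarrow> g \<in> V \<Longrightarrow> L (\<lambda>x. f x + g x) = L f + L g"
  by (simp add: linear_functional_on_def)

lemma linear_functional_on_scale:
  "linear_functional_on V L \<Longrightarrow> f \<in> V \<Longrightarrow> L (\<lambda>x. c * f x) = c * L f"
  by (simp add: linear_functional_on_def)

lemma linear_functional_on_zero:
  assumes V: "function_space V" and L: "linear_functional_on V L" and f: "f \<in> V"
  shows "L (\<lambda>x. 0) = 0"
  using linear_functional_on_scale[OF L f, of 0] by simp

lemma linear_functional_on_sum:
  assumes V: "function_space V" and L: "linear_functional_on V L"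
    and z: "(\<lambda>x. 0) \<in> V" and f: "\<And>i. i \<in> I \<Longrightarrow> f i \<in> V"
  shows "(\<lambda>x. \<Sum>i\<in>I. f i x) \<in> V \<and> L (\<lambda>x. \<Sum>i\<in>I. f i x) = (\<Sum>i\<in>I. L (f i))"
  using f
proof (induction I rule: infinite_finite_induct)
  case (insert i I)
  then show ?case
    using function_space_add[OF V, of "f i" "\<lambda>x. \<Sum>i\<in>I. f i x"] L
    by (simp add: linear_functional_on_def)
qed (use z linear_functional_on_zero[OF V L z] in auto)

lemma linear_functional_on_mono:
  assumes V: "function_space V" and L: "linear_functional_on V L"
    and pos: "positive_functional_on V K L"
    and fg: "f \<in> V" "g \<in> V" "\<And>x. x \<in> K \<Longrightarrow> f x \<le> g x"
  shows "L f \<le> L g"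
proof -
  have m: "(\<lambda>x. - 1 * f x) \<in> V" by (rule function_space_scale[OF V fg(1)])
  have "0 \<le> L (\<lambda>x. g x + - 1 * f x)"
    using pos function_space_add[OF V fg(2) m] fg(3) by (simp add: positive_functional_on_def)
  also have "\<dots> = L g + L (\<lambda>x. - 1 * f x)"
    by (rule linear_functional_on_add[OF L fg(2) m])
  also have "L (\<lambda>x. - 1 * f x) = - 1 * L f"
    by (rule linear_functional_on_scale[OF L fg(1)])
  finally show ?thesis by simp
qed

section \<open>Nested intervals of prescribed length\<close>

text \<open>The next three lemmas cut an interval of length \<open>sum w J\<close> into consecutive half-open
  pieces, one of length \<open>w z\<close> for each \<open>z\<close> in \<open>J\<close>, in the order that \<open>to_nat\<close> puts on \<open>J\<close>:
  the pieces are disjoint, they stay inside the interval, and they cover it.\<close>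

lemma interval_partition_unique:
  fixes J :: "'z::countable set" and w :: "'z \<Rightarrow> real"
  assumes fin: "finite J" and w: "\<And>z. 0 \<le> w z"
  defines "s \<equiv> \<lambda>z. sum w {y \<in> J. to_nat y < to_nat z}"
  assumes z: "z \<in> J" "a + s z \<le> t" "t < a + s z + w z"
    and z': "z' \<in> J" "a + s z' \<le> t" "t < a + s z' + w z'"
  shows "z = z'"
proof -
  have le: "s z + w z \<le> s z'" if "to_nat z < to_nat z'" "z \<in> J" for z z'
  proof -
    have "s z + w z = sum w (insert z {y \<in> J. to_nat y < to_nat z})"
      using fin by (simp add: s_def)
    also have "\<dots> \<le> s z'"
      unfolding s_def using fin that w by (intro sum_mono2) auto
    finally show ?thesis .
  qed
  have "to_nat z = to_nat z'"
    using le[of z z'] le[of z' z] z z' by (cases "to_nat z" "to_nat z'" rule: linorder_cases) auto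
  then show ?thesis by simp
qed

lemma interval_partition_subset:
  fixes J :: "'z::countable set" and w :: "'z \<Rightarrow> real"
  assumes fin: "finite J" and w: "\<And>z. 0 \<le> w z" and z: "z \<in> J"
  shows "0 \<le> sum w {y \<in> J. to_nat y < to_nat z}"
    and "sum w {y \<in> J. to_nat y < to_nat z} + w z \<le> sum w J"
proof -
  show "0 \<le> sum w {y \<in> J. to_nat y < to_nat z}" by (intro sum_nonneg w)
  have "sum w {y \<in> J. to_nat y < to_nat z} + w z = sum w (insert z {y \<in> J. to_nat y < to_nat z})"
    using fin by simp
  also have "\<dots> \<le> sum w J"
    using fin z w by (intro sum_mono2) auto
  finally show "sum w {y \<in> J. to_nat y < to_nat z} + w z \<le> sum w J" .
qed

lemma interval_partition_cover:
  fixes J :: "'z::countable set" and w :: "'z \<Rightarrow> real"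
  assumes fin: "finite J" and t: "a \<le> t" "t < a + sum w J"
  shows "\<exists>z\<in>J. a + sum w {y \<in> J. to_nat y < to_nat z} \<le> t \<and>
      t < a + sum w {y \<in> J. to_nat y < to_nat z} + w z"
  using fin t
proof (induction J rule: finite_ranking_induct[where f = "to_nat :: 'z \<Rightarrow> nat"])
  case empty
  then show ?case by simp
next
  case (insert x S)
  show ?case
  proof (cases "x \<in> S")
    case True
    then show ?thesis using insert by (simp add: insert_absorb)
  next
    case False
    have below: "to_nat y < to_nat x" if "y \<in> S" for y
      using insert.hyps(2)[OF that] False that by (metis le_neq_implies_less to_nat_split inj_to_nat injD)
    have top: "{y \<in> insert x S. to_nat y < to_nat x} = S" using below by auto
    have rest: "{y \<in> insert x S. to_nat y < to_nat z} = {y \<in> S. to_nat y < to_nat z}" if "z \<in> S" for z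
      using below[OF that] by auto
    show ?thesis
    proof (cases "t < a + sum w S")
      case True
      then obtain z where "z \<in> S" "a + sum w {y \<in> S. to_nat y < to_nat z} \<le> t"
        "t < a + sum w {y \<in> S. to_nat y < to_nat z} + w z"
        using insert.IH insert.prems by auto
      then show ?thesis using rest[of z] by (intro bexI[of _ z]) auto
    next
      case x: False
      then show ?thesis
        using insert.prems False insert.hyps(1) top by (intro bexI[of _ x]) (auto simp: algebra_simps)
    qed
  qed
qed

text \<open>The function \<open>e k\<close> labels each point of \<open>E\<close> by a node of level \<open>k\<close> of the tree with parent
  map \<open>h\<close>, and Lebesgue measure gives each node the weight \<open>w k\<close>. Nodes of weight 0 are
  not attained at all, rather than only on a null set, so that consequences hold
  everywhere on \<open>E\<close>.\<close>

definition realizes_weights ::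
    "(nat \<Rightarrow> 'z \<Rightarrow> real) \<Rightarrow> ('z \<Rightarrow> 'z) \<Rightarrow> real set \<Rightarrow> (nat \<Rightarrow> real \<Rightarrow> 'z) \<Rightarrow> bool" where
  "realizes_weights w h E e \<longleftrightarrow>
     E \<in> sets borel \<and>
     (\<forall>k z. {t \<in> E. e k t = z} \<in> sets borel) \<and>
     (\<forall>k z. emeasure lborel {t \<in> E. e k t = z} = ennreal (w k z)) \<and>
     (\<forall>k. \<forall>t\<in>E. 0 < w k (e k t)) \<and>
     (\<forall>k. \<forall>t\<in>E. h (e (Suc k) t) = e k t)"

text \<open>The set of points with label \<open>z\<close> at level \<open>k\<close> is a half-open interval of length \<open>w k z\<close>,
  empty when the weight is 0. Passing to the next level cuts each interval into
  pieces for the children of its node, which fit exactly because the weights of the children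
  add up.\<close>

lemma nested_interval_realization:
  fixes w :: "nat \<Rightarrow> 'z::countable \<Rightarrow> real" and h :: "'z \<Rightarrow> 'z"
  assumes nonneg: "\<And>k z. 0 \<le> w k z"
    and fin: "\<And>y. finite {z. h z = y}"
    and split: "\<And>k y. w k y = (\<Sum>z | h z = y. w (Suc k) z)"
    and bound: "\<And>z. w 0 z \<le> M"
  shows "\<exists>E e. realizes_weights w h E e"
proof -
  \<comment> \<open>The left endpoints. At level 0 the spacing \<open>M\<close> bounds all the lengths, so the
      intervals are disjoint.\<close>
  define a where "a = rec_nat (\<lambda>z. M * real (to_nat z))
    (\<lambda>k b z. b (h z) + (\<Sum>y \<in> {y \<in> {y. h y = h z}. to_nat y < to_nat z}. w (Suc k) y))"
  have a0: "a 0 z = M * real (to_nat z)" for z by (simp add: a_def)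
  have aS: "a (Suc k) z = a k (h z) +
      (\<Sum>y \<in> {y \<in> {y. h y = h z}. to_nat y < to_nat z}. w (Suc k) y)" for k z
    by (simp add: a_def)
  define A where "A k z = {a k z ..< a k z + w k z}" for k z
  have sub: "A (Suc k) z \<subseteq> A k (h z)" for k z
    using interval_partition_subset[OF fin[of "h z"], of "w (Suc k)" z] nonneg split[of k "h z"]
    by (auto simp: A_def aS)
  have uniq: "z = z'" if "t \<in> A k z" "t \<in> A k z'" for k t z z'
    using that
  proof (induction k arbitrary: z z')
    case 0
    have le: "M * real (to_nat z) + w 0 z \<le> M * real (to_nat z')" if "to_nat z < to_nat z'" for z z' :: 'z
    proof -
      have "M \<ge> 0" using nonneg[of 0 z] bound[of z] by linarith
      then have "M * (real (to_nat z) + 1) \<le> M * real (to_nat z')"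
        using that by (intro mult_left_mono) auto
      then show ?thesis using bound[of z] by (simp add: algebra_simps)
    qed
    have "to_nat z = to_nat z'"
      using le[of z z'] le[of z' z] 0
      by (cases "to_nat z" "to_nat z'" rule: linorder_cases) (auto simp: A_def a0)
    then show ?case by simp
  next
    case (Suc k)
    have h: "h z = h z'" by (rule Suc.IH[OF subsetD[OF sub Suc.prems(1)] subsetD[OF sub Suc.prems(2)]])
    show ?case
      using interval_partition_unique[OF fin[of "h z"], of "w (Suc k)" z "a k (h z)" t z'] nonneg Suc.prems h
      by (simp add: A_def aS)
  qed
  have cover: "\<exists>z. h z = y \<and> t \<in> A (Suc k) z" if "t \<in> A k y" for k t y
    using interval_partition_cover[OF fin[of y], of "a k y" t "w (Suc k)"] that split[of k y]
    by (auto simp: A_def aS)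
  define E where "E = (\<Union>z. A 0 z)"
  have ex: "\<exists>z. t \<in> A k z" if "t \<in> E" for t k
    using that
  proof (induction k)
    case 0
    then show ?case by (auto simp: E_def)
  next
    case (Suc k)
    then obtain z where "t \<in> A k z" by blast
    then show ?case using cover[of t k z] by blast
  qed
  have in_E: "t \<in> E" if "t \<in> A k z" for t k z
    using that
  proof (induction k arbitrary: z)
    case 0
    then show ?case by (auto simp: E_def)
  next
    case (Suc k)
    show ?case by (rule Suc.IH[OF subsetD[OF sub Suc.prems]])
  qed
  define e where "e k t = (THE z. t \<in> A k z)" for k t
  have e: "t \<in> A k (e k t)" if "t \<in> E" for k t
  proof -
    obtain z where z: "t \<in> A k z" using ex[OF \<open>t \<in> E\<close>] by blast
    show ?thesis unfolding e_def by (rule theI[of _ z]) (use z uniq in auto)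
  qed
  have level: "{t \<in> E. e k t = z} = A k z" for k z
  proof (intro set_eqI iffI)
    fix t assume t: "t \<in> A k z"
    show "t \<in> {t \<in> E. e k t = z}" using in_E[OF t] uniq[OF e[OF in_E[OF t]] t] by simp
  qed (use e in auto)
  have "realizes_weights w h E e"
    unfolding realizes_weights_def
  proof (intro conjI allI ballI)
    show "E \<in> sets borel" unfolding E_def A_def by (rule sets.countable_UN') auto
    show "{t \<in> E. e k t = z} \<in> sets borel" for k z by (simp add: level A_def)
    show "emeasure lborel {t \<in> E. e k t = z} = ennreal (w k z)" for k z
      using nonneg[of k z] by (simp add: level A_def)
    show "0 < w k (e k t)" if t: "t \<in> E" for k t
      using e[OF t, of k] by (simp add: A_def)
    show "h (e (Suc k) t) = e k t" if t: "t \<in> E" for k t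
      using uniq[OF subsetD[OF sub e[OF t, of "Suc k"]] e[OF t, of k]] .
  qed
  then show ?thesis by blast
qed

section \<open>Dyadic cubes\<close>

text \<open>Level \<open>k\<close> cubes have side \<open>1 / 2 ^ k\<close> and are indexed by integer vectors \<open>z\<close>; the lower corner
  of cube \<open>z\<close> is \<open>z / 2 ^ k\<close>.\<close>

definition dyadic_cell :: "nat \<Rightarrow> real^'n \<Rightarrow> int^'n" where
  "dyadic_cell k x = (\<chi> i. \<lfloor>2 ^ k * x $ i\<rfloor>)"

definition dyadic_corner :: "nat \<Rightarrow> int^'n \<Rightarrow> real^'n" where
  "dyadic_corner k z = (\<chi> i. of_int (z $ i) / 2 ^ k)"

definition dyadic_parent :: "int^'n \<Rightarrow> int^'n" where
  "dyadic_parent z = (\<chi> i. z $ i div 2)"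

lemma int_div_2_bounds: "2 * (a div 2) \<le> a" "a \<le> 2 * (a div 2) + 1" for a :: int
  by presburger+

lemma floor_double_div_2: "\<lfloor>2 * x\<rfloor> div 2 = \<lfloor>x :: real\<rfloor>"
proof (rule floor_unique[symmetric])
  have "2 * real_of_int (\<lfloor>2 * x\<rfloor> div 2) \<le> of_int \<lfloor>2 * x\<rfloor>"
    "of_int \<lfloor>2 * x\<rfloor> \<le> 2 * real_of_int (\<lfloor>2 * x\<rfloor> div 2) + 1"
    using int_div_2_bounds[of "\<lfloor>2 * x\<rfloor>"] by linarith+
  then show "of_int (\<lfloor>2 * x\<rfloor> div 2) \<le> x" "x < of_int (\<lfloor>2 * x\<rfloor> div 2) + 1"
    by linarith+
qed

lemma dyadic_parent_cell: "dyadic_parent (dyadic_cell (Suc k) x) = dyadic_cell k x"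
  by (simp add: dyadic_parent_def dyadic_cell_def mult.assoc floor_double_div_2)

lemma dyadic_corner_cell:
  "dyadic_corner k (dyadic_cell k x) $ i \<le> x $ i"
  "x $ i \<le> dyadic_corner k (dyadic_cell k x) $ i + 1 / 2 ^ k"
proof -
  have "of_int \<lfloor>2 ^ k * x $ i\<rfloor> \<le> 2 ^ k * x $ i" "2 ^ k * x $ i \<le> of_int \<lfloor>2 ^ k * x $ i\<rfloor> + 1"
    by linarith+
  then show "dyadic_corner k (dyadic_cell k x) $ i \<le> x $ i"
    "x $ i \<le> dyadic_corner k (dyadic_cell k x) $ i + 1 / 2 ^ k"
    by (simp_all add: dyadic_corner_def dyadic_cell_def field_simps)
qed

lemma finite_int_box:
  assumes "\<And>i. finite (F i)"
  shows "finite {z :: int^'n::finite. \<forall>i. z $ i \<in> F i}"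
proof (rule finite_imageD)
  have "vec_nth ` {z :: int^'n. \<forall>i. z $ i \<in> F i} \<subseteq> Pi\<^sub>E UNIV F" by auto
  then show "finite (vec_nth ` {z :: int^'n. \<forall>i. z $ i \<in> F i})"
    by (rule finite_subset) (intro finite_PiE assms finite)
qed (auto simp: inj_on_def vec_eq_iff)

lemma finite_dyadic_children: "finite {z :: int^'n::finite. dyadic_parent z = y}"
proof (rule finite_subset)
  show "{z. dyadic_parent z = y} \<subseteq> {z. \<forall>i. z $ i \<in> {2 * y $ i .. 2 * y $ i + 1}}"
    using int_div_2_bounds by (auto simp: dyadic_parent_def)
qed (intro finite_int_box, simp)

lemma finite_dyadic_corner_bounded: "finite {z :: int^'n::finite. norm (dyadic_corner k z) \<le> R}"
proof (rule finite_subset)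
  show "{z :: int^'n. norm (dyadic_corner k z) \<le> R} \<subseteq> {z. \<forall>i. z $ i \<in> {\<lfloor>- (2 ^ k * R)\<rfloor> .. \<lceil>2 ^ k * R\<rceil>}}"
  proof safe
    fix z :: "int^'n" and i assume "norm (dyadic_corner k z) \<le> R"
    then have "\<bar>dyadic_corner k z $ i\<bar> \<le> R"
      using component_le_norm_cart order.trans by blast
    then have "\<bar>of_int (z $ i)\<bar> \<le> 2 ^ k * R"
      by (simp add: dyadic_corner_def field_simps)
    then show "z $ i \<in> {\<lfloor>- (2 ^ k * R)\<rfloor> .. \<lceil>2 ^ k * R\<rceil>}"
      by (simp add: abs_le_iff) linarith
  qed
qed (intro finite_int_box, simp)

lemma dyadic_dist_le:
  fixes x y :: "real^'n::finite"
  assumes "\<And>i. c $ i \<le> x $ i \<and> x $ i \<le> c $ i + 1 / 2 ^ k" "\<And>i. c $ i \<le> y $ i \<and> y $ i \<le> c $ i + 1 / 2 ^ k"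
  shows "dist x y \<le> CARD('n) / 2 ^ k"
proof -
  have "dist x y \<le> (\<Sum>i\<in>UNIV. \<bar>(x - y) $ i\<bar>)"
    unfolding dist_norm by (rule norm_le_l1_cart)
  also have "\<dots> \<le> (\<Sum>i\<in>(UNIV::'n set). 1 / 2 ^ k)"
  proof (rule sum_mono)
    fix i
    show "\<bar>(x - y) $ i\<bar> \<le> 1 / 2 ^ k" using assms(1)[of i] assms(2)[of i]
      unfolding vector_minus_component abs_le_iff by linarith
  qed
  finally show ?thesis by simp
qed

text \<open>In each coordinate the lower faces of the cubes increase, the upper faces decrease, and
  their distance tends to 0. The limit lies in the closed cubes, though possibly not in
  the half-open ones; this is how mass infinitely close to a face is moved onto the face.\<close>

lemma dyadic_limit_point:
  fixes z :: "nat \<Rightarrow> int^'n::finite"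
  assumes z: "\<And>k. dyadic_parent (z (Suc k)) = z k"
  obtains x where "\<And>k i. dyadic_corner k (z k) $ i \<le> x $ i"
    "\<And>k i. x $ i \<le> dyadic_corner k (z k) $ i + 1 / 2 ^ k"
proof -
  have "\<exists>l. (\<forall>k. dyadic_corner k (z k) $ i \<le> l) \<and> (\<forall>k. l \<le> dyadic_corner k (z k) $ i + 1 / 2 ^ k)" for i
  proof -
    let ?f = "\<lambda>k. dyadic_corner k (z k) $ i" and ?g = "\<lambda>k. dyadic_corner k (z k) $ i + 1 / 2 ^ k"
    have p: "z k $ i = z (Suc k) $ i div 2" for k
      by (subst z[of k, symmetric]) (simp add: dyadic_parent_def)
    have i: "2 * z k $ i \<le> z (Suc k) $ i" "z (Suc k) $ i \<le> 2 * z k $ i + 1" for k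
      using int_div_2_bounds[of "z (Suc k) $ i"] p[of k] by linarith+
    have r: "2 * real_of_int (z k $ i) \<le> of_int (z (Suc k) $ i)"
       "of_int (z (Suc k) $ i) \<le> 2 * real_of_int (z k $ i) + 1" for k
      using i[of k] by linarith+
    have "\<exists>l. ((\<forall>k. ?f k \<le> l) \<and> ?f \<longlonglongrightarrow> l) \<and> ((\<forall>k. l \<le> ?g k) \<and> ?g \<longlonglongrightarrow> l)"
    proof (rule nested_sequence_unique)
      have "?f k \<le> ?f (Suc k)" "?g (Suc k) \<le> ?g k" for k
        using mult_left_mono[OF r(1)[of k], of "2 ^ k"] mult_left_mono[OF r(2)[of k], of "2 ^ k"]
        by (simp_all add: dyadic_corner_def field_simps)
      then show "\<forall>k. ?f k \<le> ?f (Suc k)" "\<forall>k. ?g (Suc k) \<le> ?g k" by blast+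
      have "(\<lambda>k. - ((1/2) ^ k :: real)) \<longlonglongrightarrow> - 0"
        by (intro tendsto_minus LIMSEQ_power_zero) simp
      then show "(\<lambda>k. ?f k - ?g k) \<longlonglongrightarrow> 0" by (simp add: power_one_over)
    qed simp
    then show ?thesis by blast
  qed
  then obtain l where "\<And>i. (\<forall>k. dyadic_corner k (z k) $ i \<le> l i) \<and>
      (\<forall>k. l i \<le> dyadic_corner k (z k) $ i + 1 / 2 ^ k)" by metis
  then show thesis by (intro that[of "\<chi> i. l i"]) auto
qed

section \<open>From a positive functional to a measure\<close>

lemma compact_support_uniformly_continuous:
  fixes f :: "'a::euclidean_space \<Rightarrow> real"
  assumes f: "continuous_on UNIV f" and supp: "\<And>x. R < norm x \<Longrightarrow> f x = 0"
  shows "uniformly_continuous_on UNIV f"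
  unfolding uniformly_continuous_on_def
proof (intro allI impI)
  fix e :: real assume e: "0 < e"
  have "uniformly_continuous_on (cball 0 (R + 1)) f"
    using f by (intro compact_uniformly_continuous) (auto intro: continuous_on_subset)
  then obtain d where d: "d > 0"
    "\<And>x y. x \<in> cball 0 (R + 1) \<Longrightarrow> y \<in> cball 0 (R + 1) \<Longrightarrow> dist y x < d \<Longrightarrow> dist (f y) (f x) < e"
    using e unfolding uniformly_continuous_on_def by metis
  have "dist (f y) (f x) < e" if "dist y x < min d 1" for x y
  proof (cases "norm x \<le> R + 1 \<and> norm y \<le> R + 1")
    case True
    then show ?thesis using d that by auto
  next
    case False
    have "\<bar>norm x - norm y\<bar> < 1"
      using that norm_triangle_ineq3[of x y] by (simp add: dist_norm norm_minus_commute)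
    then have "R < norm x" "R < norm y" using False by auto
    then show ?thesis using supp e by simp
  qed
  then show "\<exists>d>0. \<forall>x\<in>UNIV. \<forall>x'\<in>UNIV. dist x' x < d \<longrightarrow> dist (f x') (f x) < e"
    using d(1) by (intro exI[of _ "min d 1"]) auto
qed

lemma compact_support_bounded:
  fixes f :: "'a::euclidean_space \<Rightarrow> real"
  assumes f: "continuous_on UNIV f" and supp: "\<And>x. R < norm x \<Longrightarrow> f x = 0"
  shows "bounded (range f)"
proof (rule bounded_subset)
  have "bounded (f ` cball 0 R)"
    using f by (intro compact_imp_bounded compact_continuous_image) (auto intro: continuous_on_subset)
  then show "bounded (insert 0 (f ` cball 0 R))" by simp
  show "range f \<subseteq> insert 0 (f ` cball 0 R)" using supp by (force simp: image_iff not_less)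
qed

text \<open>The tree of dyadic cubes, weighted by the values of \<open>L\<close> on their indicators, is realised by
  intervals in the real line, and \<open>X t\<close> is the limit of the cubes that \<open>t\<close> selects. A cube of positive
  mass meets \<open>K\<close>, so \<open>X\<close> takes values in the closed set \<open>K\<close>, and the measure is the image of
  Lebesgue measure under \<open>X\<close>. A function that is constant on cubes of level \<open>k\<close> and
  vanishes on all but finitely many has the same value under \<open>L\<close> as under
  integration along the labelling; a continuous function of
  compact support is a uniform limit of such functions, and both functionals have mass at most \<open>L 1\<close>.\<close>

lemma riesz_representation_bounded:
  fixes K :: "(real^'n::finite) set" and L :: "(real^'n \<Rightarrow> real) \<Rightarrow> real"
  assumes K: "closed K"
    and V: "function_space V" and bnd: "\<And>f. bounded (range f) \<Longrightarrow> f \<in> V"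
    and L: "linear_functional_on V L"
    and pos: "positive_functional_on V K L"
  obtains \<mu> where "sets \<mu> = sets (restrict_space borel K)" "finite_measure \<mu>"
    "\<And>f R. continuous_on UNIV f \<Longrightarrow> (\<And>x. R < norm x \<Longrightarrow> f x = 0) \<Longrightarrow>
        integrable \<mu> f \<and> (\<integral>x. f x \<partial>\<mu>) = L f"
proof -
  define cell where "cell k z x = (if dyadic_cell k x = z then 1 else 0 :: real)" for k z and x :: "real^'n"
  define w where "w k z = L (cell k z)" for k z
  define M where "M = L (\<lambda>x. 1)"
  have bounded_by: "f \<in> V" if "\<And>x. \<bar>f x\<bar> \<le> B" for f :: "real^'n \<Rightarrow> real" and B
    using that by (intro bnd) (auto simp: bounded_iff)
  have one: "(\<lambda>x. 1) \<in> V" and zero: "(\<lambda>x. 0) \<in> V"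
    by (auto intro: bounded_by[of _ 1])
  have cellV: "cell k z \<in> V" for k z
    by (rule bounded_by[of _ 1]) (simp add: cell_def)
  note mono = linear_functional_on_mono[OF V L pos]
  note sumL = linear_functional_on_sum[OF V L zero]
  have scaleL: "L (\<lambda>x. c * f x) = c * L f" if "f \<in> V" for c f
    by (rule linear_functional_on_scale[OF L that])
  have M0: "0 \<le> M" using pos one by (simp add: M_def positive_functional_on_def)
  have w0: "0 \<le> w k z" for k z
    using pos cellV by (simp add: w_def positive_functional_on_def cell_def)
  have w_sum_le: "(\<Sum>z\<in>F. w k z) \<le> M" if "finite F" for F k
  proof -
    have "(\<Sum>z\<in>F. w k z) = L (\<lambda>x. \<Sum>z\<in>F. cell k z x)"
      unfolding w_def using sumL[of F "cell k"] cellV by simp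
    also have "\<dots> \<le> M"
      unfolding M_def
    proof (rule mono[OF _ one])
      show "(\<lambda>x. \<Sum>z\<in>F. cell k z x) \<in> V" using sumL[of F "cell k"] cellV by simp
      show "(\<Sum>z\<in>F. cell k z x) \<le> 1" for x using that by (simp add: cell_def sum.delta)
    qed
    finally show ?thesis .
  qed
  have split: "w k y = (\<Sum>z | dyadic_parent z = y. w (Suc k) z)" for k y
  proof -
    have "cell k y = (\<lambda>x. \<Sum>z | dyadic_parent z = y. cell (Suc k) z x)"
      by (rule ext) (simp add: cell_def sum.delta finite_dyadic_children flip: dyadic_parent_cell[of k])
    then show ?thesis
      unfolding w_def using sumL[of "{z. dyadic_parent z = y}" "cell (Suc k)"] cellV by simp
  qed
  have wM: "w 0 z \<le> M" for z using w_sum_le[of "{z}" 0] by simp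
  obtain E e where tree: "realizes_weights w dyadic_parent E e"
    using nested_interval_realization[of w dyadic_parent M, OF w0 finite_dyadic_children split wM] by blast
  have E: "E \<in> sets borel"
    and lev: "\<And>k z. {t \<in> E. e k t = z} \<in> sets borel"
    and em: "\<And>k z. emeasure lborel {t \<in> E. e k t = z} = ennreal (w k z)"
    and wpos: "\<And>k t. t \<in> E \<Longrightarrow> 0 < w k (e k t)"
    and par: "\<And>k t. t \<in> E \<Longrightarrow> dyadic_parent (e (Suc k) t) = e k t"
    using tree unfolding realizes_weights_def by simp_all
  define N where "N = restrict_space lborel E"
  have spN: "space N = E" by (simp add: N_def space_restrict_space)
  have levN: "{t \<in> E. e k t = z} \<in> sets N" for k z
    using E lev by (simp add: N_def sets_restrict_space_iff)
  have emN: "emeasure N {t \<in> E. e k t = z} = ennreal (w k z)" for k z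
    unfolding N_def using E em by (subst emeasure_restrict_space) auto
  \<comment> \<open>Positivity bounds only finite sums of weights, hence the exhaustion of \<open>E\<close> by
      finitely many cubes at a time.\<close>
  have massN: "emeasure N E \<le> ennreal M"
  proof -
    define A where "A n = {t \<in> E. to_nat (e 0 t) < n}" for n
    have fin: "finite {z :: int^'n. to_nat z < n}" for n
      by (rule finite_imageD[of to_nat]) (auto intro: finite_subset[of _ "{..<n}"] inj_on_subset[OF inj_to_nat])
    have A: "A n = (\<Union>z\<in>{z. to_nat z < n}. {t \<in> E. e 0 t = z})" for n
      by (auto simp: A_def)
    have "emeasure N (A n) \<le> ennreal M" for n
    proof -
      have "emeasure N (A n) = (\<Sum>z | to_nat z < n. emeasure N {t \<in> E. e 0 t = z})"
        unfolding A using levN fin by (intro sum_emeasure[symmetric]) (auto simp: disjoint_family_on_def)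
      also have "\<dots> = ennreal (\<Sum>z | to_nat z < n. w 0 z)"
        by (simp add: emN w0)
      also have "\<dots> \<le> ennreal M" by (intro ennreal_leI w_sum_le fin)
      finally show ?thesis .
    qed
    moreover have "(SUP n. emeasure N (A n)) = emeasure N (\<Union>n. A n)"
      using A levN fin by (intro SUP_emeasure_incseq) (auto simp: incseq_def A_def intro!: sets.finite_UN)
    moreover have "(\<Union>n. A n) = E" by (auto simp: A_def)
    ultimately show ?thesis by (metis SUP_least)
  qed
  interpret N: finite_measure N
    using massN by (intro finite_measureI) (auto simp: spN top_unique)
  have massN': "measure N E \<le> M"
    using massN M0 by (simp add: N.emeasure_eq_measure)
  have "\<exists>x. \<forall>k i. dyadic_corner k (e k t) $ i \<le> x $ i \<and> x $ i \<le> dyadic_corner k (e k t) $ i + 1 / 2 ^ k"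
    if "t \<in> E" for t
    using dyadic_limit_point[of "\<lambda>k. e k t"] par[OF that] by metis
  then obtain X where X: "\<And>t k i. t \<in> E \<Longrightarrow> dyadic_corner k (e k t) $ i \<le> X t $ i \<and>
      X t $ i \<le> dyadic_corner k (e k t) $ i + 1 / 2 ^ k" by metis
  have small: "\<exists>k. CARD('n) / 2 ^ k < \<epsilon>" if "0 < \<epsilon>" for \<epsilon> :: real
  proof -
    have "0 < \<epsilon> / CARD('n)" using that by simp
    from real_arch_pow_inv[OF this, of "1/2"] obtain k where "(1/2) ^ k < \<epsilon> / CARD('n)" by auto
    then show ?thesis by (intro exI[of _ k]) (simp add: field_simps power_one_over)
  qed
  have X_close: "dist (dyadic_corner k (e k t)) (X t) \<le> CARD('n) / 2 ^ k" if "t \<in> E" for k t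
    using X[OF that] by (intro dyadic_dist_le) auto
  have X_lim: "(\<lambda>k. dyadic_corner k (e k t)) \<longlonglongrightarrow> X t" if "t \<in> E" for t
  proof (rule metric_LIMSEQ_I)
    fix \<epsilon> :: real assume "0 < \<epsilon>"
    then obtain n where n: "CARD('n) / 2 ^ n < \<epsilon>" using small by blast
    have "dist (dyadic_corner k (e k t)) (X t) < \<epsilon>" if "n \<le> k" for k
    proof -
      have "CARD('n) / (2::real) ^ k \<le> CARD('n) / 2 ^ n"
        using that by (intro divide_left_mono power_increasing) auto
      then show ?thesis using X_close[OF \<open>t \<in> E\<close>, of k] n by linarith
    qed
    then show "\<exists>n. \<forall>k\<ge>n. dist (dyadic_corner k (e k t)) (X t) < \<epsilon>" by blast
  qed
  have e_meas: "e k \<in> measurable N (count_space UNIV)" for k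
  proof (subst measurable_count_space_eq_countable)
    show "e k \<in> space N \<rightarrow> UNIV \<and> (\<forall>a\<in>UNIV. e k -` {a} \<inter> space N \<in> sets N)"
    proof (intro conjI ballI)
      fix z
      have "e k -` {z} \<inter> space N = {t \<in> E. e k t = z}" by (auto simp: spN)
      then show "e k -` {z} \<inter> space N \<in> sets N" using levN by simp
    qed simp
  qed simp
  have X_meas: "X \<in> borel_measurable N"
    by (rule borel_measurable_LIMSEQ_metric[of "\<lambda>k t. dyadic_corner k (e k t)"])
      (use X_lim in \<open>auto simp: spN intro!: measurable_compose[OF e_meas]\<close>)
  have X_K: "X t \<in> K" if t: "t \<in> E" for t
  proof -
    have "\<exists>x\<in>K. dist x (X t) < \<epsilon>" if "0 < \<epsilon>" for \<epsilon>
    proof -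
      obtain k where k: "CARD('n) / 2 ^ k < \<epsilon>" using small \<open>0 < \<epsilon>\<close> by blast
      \<comment> \<open>Otherwise the indicator of the cube vanishes on \<open>K\<close>, and the cube has weight 0.\<close>
      have "\<exists>x\<in>K. dyadic_cell k x = e k t"
      proof (rule ccontr)
        assume "\<not> ?thesis"
        then have "w k (e k t) \<le> L (\<lambda>x. 0)"
          unfolding w_def by (intro mono cellV zero) (auto simp: cell_def)
        then show False
          using wpos[OF t, of k] linear_functional_on_zero[OF V L one] by simp
      qed
      then obtain x where x: "x \<in> K" "dyadic_cell k x = e k t" by blast
      have "dist x (X t) \<le> CARD('n) / 2 ^ k"
        using dyadic_corner_cell[where k = k and x = x] X[OF t, of k] by (intro dyadic_dist_le[of "dyadic_corner k (e k t)"]) (auto simp: x(2))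
      then show ?thesis using x(1) k by (intro bexI[of _ x]) auto
    qed
    then show ?thesis using K by (metis closed_approachable)
  qed
  have X_measK: "X \<in> measurable N (restrict_space borel K)"
    using X_meas X_K by (intro measurable_restrict_space2) (auto simp: spN)
  show thesis
  proof (rule that[of "distr N (restrict_space borel K) X"])
    show "finite_measure (distr N (restrict_space borel K) X)"
      by (rule N.finite_measure_distr[OF X_measK])
    fix f :: "real^'n \<Rightarrow> real" and R
    assume cont: "continuous_on UNIV f" and supp: "\<And>x. R < norm x \<Longrightarrow> f x = 0"
    have uc: "uniformly_continuous_on UNIV f"
      using compact_support_uniformly_continuous[OF cont supp] .
    have "bounded (range f)" using compact_support_bounded[OF cont supp] .
    then obtain B where B: "\<And>x. \<bar>f x\<bar> \<le> B" by (auto simp: bounded_iff)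
    have fV: "f \<in> V" using bounded_by B .
    have f_meas: "f \<in> borel_measurable borel"
      using cont by (rule borel_measurable_continuous_onI)
    have f_measK: "f \<in> borel_measurable (restrict_space borel K)"
      using f_meas by (rule measurable_restrict_space1)
    have fX_meas: "(\<lambda>t. f (X t)) \<in> borel_measurable N"
      using measurable_compose[OF X_meas f_meas] .
    have fX_int: "integrable N (\<lambda>t. f (X t))"
      using fX_meas B by (intro N.integrable_const_bound[of _ B]) auto
    have step_meas: "(\<lambda>t. f (dyadic_corner k (e k t))) \<in> borel_measurable N" for k
      by (rule measurable_compose[OF e_meas]) simp
    have step_int: "integrable N (\<lambda>t. f (dyadic_corner k (e k t)))" for k
      using step_meas B by (intro N.integrable_const_bound[of _ B]) auto
    \<comment> \<open>Only the finitely many cubes with lower corner in the ball of radius \<open>R\<close> contribute.\<close>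
    have step: "(\<integral>t. f (dyadic_corner k (e k t)) \<partial>N) = L (\<lambda>x. f (dyadic_corner k (dyadic_cell k x)))" for k
    proof -
      define Z where "Z = {z :: int^'n. norm (dyadic_corner k z) \<le> R}"
      have Z: "finite Z" unfolding Z_def by (rule finite_dyadic_corner_bounded)
      have out: "f (dyadic_corner k z) = 0" if "z \<notin> Z" for z
        using supp that by (auto simp: Z_def)
      have "(\<integral>t. f (dyadic_corner k (e k t)) \<partial>N) =
          (\<integral>t. (\<Sum>z\<in>Z. f (dyadic_corner k z) * indicator {t \<in> E. e k t = z} t) \<partial>N)"
      proof (rule Bochner_Integration.integral_cong[OF refl])
        fix t assume "t \<in> space N"
        then show "f (dyadic_corner k (e k t)) = (\<Sum>z\<in>Z. f (dyadic_corner k z) * indicator {t \<in> E. e k t = z} t)"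
          using Z out[of "e k t"]
          by (cases "e k t \<in> Z") (simp_all add: spN indicator_def if_distrib sum.delta cong: if_cong)
      qed
      also have "\<dots> = (\<Sum>z\<in>Z. \<integral>t. f (dyadic_corner k z) * indicator {t \<in> E. e k t = z} t \<partial>N)"
        using levN by (intro Bochner_Integration.integral_sum integrable_mult_right integrable_real_indicator) (auto simp: N.emeasure_finite less_top[symmetric])
      also have "\<dots> = (\<Sum>z\<in>Z. f (dyadic_corner k z) * w k z)"
        using levN sets.sets_into_space[OF levN] by (intro sum.cong) (auto simp: measure_def emN w0 Int_absorb2)
      also have "\<dots> = (\<Sum>z\<in>Z. L (\<lambda>x. f (dyadic_corner k z) * cell k z x))"
        by (simp add: w_def scaleL cellV)
      also have "\<dots> = L (\<lambda>x. \<Sum>z\<in>Z. f (dyadic_corner k z) * cell k z x)"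
        using sumL[of Z "\<lambda>z x. f (dyadic_corner k z) * cell k z x"] function_space_scale[OF V cellV] by simp
      also have "(\<lambda>x. \<Sum>z\<in>Z. f (dyadic_corner k z) * cell k z x) = (\<lambda>x. f (dyadic_corner k (dyadic_cell k x)))"
        using Z out by (auto simp: cell_def if_distrib sum.delta cong: if_cong)
      finally show ?thesis .
    qed
    have approx: "\<bar>(\<integral>t. f (X t) \<partial>N) - L f\<bar> \<le> 2 * \<epsilon> * M" if \<epsilon>: "0 < \<epsilon>" for \<epsilon>
    proof -
      obtain d where d: "d > 0" "\<And>x y. dist x y < d \<Longrightarrow> \<bar>f x - f y\<bar> < \<epsilon>"
        using uc \<epsilon> unfolding uniformly_continuous_on_def by (metis UNIV_I dist_real_def)
      obtain k where k: "CARD('n) / 2 ^ k < d" using small d(1) by blast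
      let ?g = "\<lambda>x. f (dyadic_corner k (dyadic_cell k x))"
      have gV: "?g \<in> V" using bounded_by B .
      have close: "\<bar>f x - ?g x\<bar> < \<epsilon>" for x
      proof (rule d(2))
        have "dist x (dyadic_corner k (dyadic_cell k x)) \<le> CARD('n) / 2 ^ k"
          using dyadic_corner_cell[where k = k and x = x]
          by (intro dyadic_dist_le[of "dyadic_corner k (dyadic_cell k x)"]) auto
        then show "dist x (dyadic_corner k (dyadic_cell k x)) < d" using k by simp
      qed
      have eV: "(\<lambda>x. \<epsilon> * 1) \<in> V" by (rule function_space_scale[OF V one])
      have Le: "L (\<lambda>x. g x + \<epsilon> * 1) = L g + \<epsilon> * M" if "g \<in> V" for g
        using linear_functional_on_add[OF L that eV] scaleL[OF one, of \<epsilon>] by (simp add: M_def)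
      have "L f \<le> L (\<lambda>x. ?g x + \<epsilon> * 1)"
        using close by (intro mono fV function_space_add[OF V gV eV]) (simp add: abs_less_iff, smt (verit))
      moreover have "L ?g \<le> L (\<lambda>x. f x + \<epsilon> * 1)"
        using close by (intro mono gV function_space_add[OF V fV eV]) (simp add: abs_less_iff, smt (verit))
      ultimately have 1: "\<bar>L ?g - L f\<bar> \<le> \<epsilon> * M" using Le[OF fV] Le[OF gV] by linarith
      have "\<bar>(\<integral>t. f (X t) \<partial>N) - (\<integral>t. f (dyadic_corner k (e k t)) \<partial>N)\<bar>
          = \<bar>\<integral>t. f (X t) - f (dyadic_corner k (e k t)) \<partial>N\<bar>"
        using fX_int step_int by simp
      also have "\<dots> \<le> (\<integral>t. \<bar>f (X t) - f (dyadic_corner k (e k t))\<bar> \<partial>N)"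
        by (rule integral_abs_bound)
      also have "\<dots> \<le> (\<integral>t. \<epsilon> \<partial>N)"
      proof (rule integral_mono)
        fix t assume "t \<in> space N"
        then have "dist (X t) (dyadic_corner k (e k t)) < d"
          using X_close[of t k] k by (simp add: spN dist_commute)
        then show "\<bar>f (X t) - f (dyadic_corner k (e k t))\<bar> \<le> \<epsilon>" using d(2) by (simp add: less_imp_le)
      qed (use fX_int step_int in auto)
      also have "\<dots> = \<epsilon> * measure N E" by (simp add: spN)
      also have "\<dots> \<le> \<epsilon> * M" using massN' \<epsilon> by (intro mult_left_mono) auto
      finally have "\<bar>(\<integral>t. f (X t) \<partial>N) - L ?g\<bar> \<le> \<epsilon> * M" unfolding step .
      then show ?thesis using 1 by linarith
    qed
    have "\<bar>(\<integral>t. f (X t) \<partial>N) - L f\<bar> \<le> \<delta>" if "0 < \<delta>" for \<delta>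
    proof -
      have "\<bar>(\<integral>t. f (X t) \<partial>N) - L f\<bar> \<le> 2 * (\<delta> / (2 * (M + 1))) * M"
        using that M0 by (intro approx) auto
      also have "\<dots> \<le> \<delta>" using that M0 by (simp add: field_simps)
      finally show ?thesis .
    qed
    then have "\<bar>(\<integral>t. f (X t) \<partial>N) - L f\<bar> \<le> 0" by (meson dense_ge)
    then have eq: "(\<integral>t. f (X t) \<partial>N) = L f" by simp
    show "integrable (distr N (restrict_space borel K) X) f \<and>
        (\<integral>x. f x \<partial>distr N (restrict_space borel K) X) = L f"
      using eq fX_int integrable_distr_eq[OF X_measK f_measK] integral_distr[OF X_measK f_measK] by simp
  qed simp
qed

section \<open>Polynomial functions\<close>

lemma poly_eval_superset:
  assumes "finite S" "Poly_Mapping.keys f \<subseteq> S"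
  shows "poly_eval f x =
     (\<Sum>m\<in>S. Poly_Mapping.lookup f m * (\<Prod>i\<in>UNIV. (x $ i) ^ Poly_Mapping.lookup m i))"
  unfolding poly_eval_def using assms by (intro sum.mono_neutral_left) (auto simp: in_keys_iff)

lemma poly_eval_add: "poly_eval (f + g) x = poly_eval f x + poly_eval g x"
proof -
  let ?S = "Poly_Mapping.keys f \<union> Poly_Mapping.keys g"
  have "Poly_Mapping.keys (f + g) \<subseteq> ?S" by (rule keys_add)
  then show ?thesis
    using poly_eval_superset[of ?S "f + g" x] poly_eval_superset[of ?S f x]
      poly_eval_superset[of ?S g x]
    by (simp add: lookup_add algebra_simps sum.distrib)
qed

lemma poly_eval_single:
  "poly_eval (Poly_Mapping.single m c) x = c * (\<Prod>i\<in>UNIV. (x $ i) ^ Poly_Mapping.lookup m i)"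
  by (simp add: poly_eval_def)

lemma poly_eval_zero [simp]: "poly_eval 0 x = 0"
  by (simp add: poly_eval_def)

lemma poly_eval_sum: "poly_eval (sum f A) x = (\<Sum>a\<in>A. poly_eval (f a) x)"
  by (induction A rule: infinite_finite_induct) (auto simp: poly_eval_add)

text \<open>Evaluation is multiplicative on monomials, and both sides are bilinear.\<close>

lemma poly_eval_mult: "poly_eval (f * g) x = poly_eval f x * poly_eval g x"
proof -
  have *: "h = (\<Sum>m\<in>Poly_Mapping.keys h. Poly_Mapping.single m (Poly_Mapping.lookup h m))" for h :: "'a mpoly"
    by (intro poly_mapping_eqI) (simp add: lookup_sum lookup_single when_def sum.delta in_keys_iff)
  have "f * g = (\<Sum>m\<in>Poly_Mapping.keys f. \<Sum>k\<in>Poly_Mapping.keys g.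
     Poly_Mapping.single (m + k) (Poly_Mapping.lookup f m * Poly_Mapping.lookup g k))"
    by (subst *[of f], subst *[of g]) (simp add: sum_product mult_single)
  then show ?thesis
    by (simp add: poly_eval_sum poly_eval_single lookup_add power_add prod.distrib)
      (simp add: poly_eval_def sum_product mult_ac)
qed

lemma poly_eval_const: "poly_eval (Poly_Mapping.single 0 c) x = c"
  by (simp add: poly_eval_single)

lemma poly_eval_one: "poly_eval 1 x = 1"
  using poly_eval_const[of 1 x] by simp

lemma poly_eval_scaleR: "poly_eval (c *\<^sub>R f) x = c * poly_eval f x"
proof -
  have l: "Poly_Mapping.lookup (c *\<^sub>R f) m = c * Poly_Mapping.lookup f m" for m
    by (simp add: scaleR_poly_mapping_def)
  show ?thesis
    using poly_eval_superset[of "Poly_Mapping.keys f" "c *\<^sub>R f" x]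
      poly_eval_superset[of "Poly_Mapping.keys f" f x]
    by (simp add: l sum_distrib_left mult_ac subset_iff in_keys_iff)
qed

lemma poly_eval_var:
  "poly_eval (Poly_Mapping.single (Poly_Mapping.single i 1) 1) x = x $ i"
  by (simp add: poly_eval_single lookup_single when_def if_distrib prod.delta cong: if_cong)

lemma continuous_on_poly_eval: "continuous_on S (poly_eval f)"
  unfolding poly_eval_def by (intro continuous_intros)

lemma poly_eval_norm_sq_plus_1: "\<exists>f. \<forall>x::real^'n::finite. poly_eval f x = (norm x)\<^sup>2 + 1"
proof -
  let ?X = "\<lambda>i. Poly_Mapping.single (Poly_Mapping.single i 1) 1 :: 'n mpoly"
  have "poly_eval ((\<Sum>i\<in>UNIV. ?X i * ?X i) + 1) x = (norm x)\<^sup>2 + 1"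
    for x :: "real^'n"
    unfolding poly_eval_add poly_eval_sum poly_eval_mult poly_eval_var poly_eval_one
    by (simp add: norm_vec_def L2_set_def power2_eq_square sum_nonneg)
  then show ?thesis by blast
qed

section \<open>Positive extension of a functional on polynomials\<close>

definition poly_bounded :: "(real^'n::finite \<Rightarrow> real) set" where
  "poly_bounded = {f. \<exists>q. \<forall>x. \<bar>f x\<bar> \<le> poly_eval q x}"

lemma function_space_poly_bounded: "function_space (poly_bounded :: (real^'n::finite \<Rightarrow> real) set)"
  unfolding function_space_def
proof (intro conjI ballI allI)
  fix f g :: "real^'n \<Rightarrow> real" assume "f \<in> poly_bounded" "g \<in> poly_bounded"
  then obtain p q where pq: "\<And>x. \<bar>f x\<bar> \<le> poly_eval p x" "\<And>x. \<bar>g x\<bar> \<le> poly_eval q x"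
    by (auto simp: poly_bounded_def)
  have "\<bar>f x + g x\<bar> \<le> poly_eval (p + q) x" for x
    using pq[of x] unfolding poly_eval_add by linarith
  then show "(\<lambda>x. f x + g x) \<in> poly_bounded" by (auto simp: poly_bounded_def)
next
  fix f :: "real^'n \<Rightarrow> real" and c assume "f \<in> poly_bounded"
  then obtain p where p: "\<And>x. \<bar>f x\<bar> \<le> poly_eval p x"
    by (auto simp: poly_bounded_def)
  have "\<bar>c * f x\<bar> \<le> poly_eval (\<bar>c\<bar> *\<^sub>R p) x" for x
    using p[of x] by (simp add: poly_eval_scaleR abs_mult mult_left_mono)
  then show "(\<lambda>x. c * f x) \<in> poly_bounded" by (auto simp: poly_bounded_def)
qed

lemma bounded_in_poly_bounded:
  assumes "bounded (range f)"
  shows "f \<in> poly_bounded"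
proof -
  obtain B where "\<And>x. \<bar>f x\<bar> \<le> B" using assms by (auto simp: bounded_iff)
  then show ?thesis by (auto simp: poly_bounded_def poly_eval_const intro!: exI[of _ "Poly_Mapping.single 0 B"])
qed

text \<open>Absolute values of polynomials are dominated through \<open>|a| \<le> a\<^sup>2 + 1\<close>.\<close>

lemma poly_eval_in_poly_bounded: "poly_eval q \<in> poly_bounded"
proof -
  have "\<bar>poly_eval q x\<bar> \<le> poly_eval (q * q + 1) x" for x
  proof -
    have "0 \<le> (\<bar>poly_eval q x\<bar> - 1 / 2)\<^sup>2" by simp
    then show ?thesis
      by (simp add: poly_eval_add poly_eval_mult poly_eval_one power2_eq_square algebra_simps)
  qed
  then show ?thesis by (auto simp: poly_bounded_def)
qed

text \<open>In particular \<open>l q\<close> depends only on the values of \<open>q\<close> on \<open>K\<close>.\<close>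

lemma psd_functional_mono:
  fixes l :: "'n::finite mpoly \<Rightarrow> real"
  assumes l: "linear l" and psd: "\<And>q. q \<in> Psd K \<Longrightarrow> 0 \<le> l q"
    and le: "\<And>x. x \<in> K \<Longrightarrow> poly_eval p x \<le> poly_eval q x"
  shows "l p \<le> l q"
proof -
  have "poly_eval (q + (- 1) *\<^sub>R p) x = poly_eval q x - poly_eval p x" for x
    unfolding poly_eval_add poly_eval_scaleR by simp
  then have "0 \<le> l (q + (- 1) *\<^sub>R p)"
    using le by (intro psd) (auto simp: Psd_def)
  then show ?thesis
    unfolding linear_add[OF l] linear_scale[OF l] by simp
qed

text \<open>Let \<open>p f\<close> be the infimum of \<open>l q\<close> over the polynomials \<open>q \<ge> f\<close> on \<open>K\<close>. A linear \<open>L \<le> p\<close>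
  satisfies \<open>L f \<le> l q\<close> for all such \<open>q\<close>. Applied to \<open>- f\<close> with \<open>f \<ge> 0\<close> on \<open>K\<close> and \<open>q = 0\<close> this is
  positivity; applied to a polynomial and to its negative it gives \<open>L = l\<close> on polynomials.\<close>

lemma psd_functional_extension:
  fixes l :: "'n::finite mpoly \<Rightarrow> real"
  assumes l: "linear l" and psd: "\<And>q. q \<in> Psd K \<Longrightarrow> 0 \<le> l q"
  obtains L where "linear_functional_on poly_bounded L" "positive_functional_on poly_bounded K L"
    "\<And>q. L (poly_eval q) = l q"
proof -
  define U where "U f = {q. \<forall>x\<in>K. f x \<le> poly_eval q x}" for f
  define p where "p f = (INF q\<in>U f. l q)" for f
  note mono = psd_functional_mono[OF l psd]
  have U_nonempty: "U f \<noteq> {}" if "f \<in> poly_bounded" for f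
    using that abs_le_D1 by (fastforce simp: poly_bounded_def U_def)
  have bdd: "bdd_below (l ` U f)" if f: "f \<in> poly_bounded" for f
  proof -
    obtain r where r: "\<And>x. \<bar>f x\<bar> \<le> poly_eval r x"
      using f unfolding poly_bounded_def by blast
    show ?thesis
    proof (rule bdd_belowI2[of _ "l ((- 1) *\<^sub>R r)"])
      fix q assume q: "q \<in> U f"
      show "l ((- 1) *\<^sub>R r) \<le> l q"
      proof (rule mono)
        fix x assume "x \<in> K"
        then show "poly_eval ((- 1) *\<^sub>R r) x \<le> poly_eval q x"
          using r[of x] q unfolding poly_eval_scaleR U_def by fastforce
      qed
    qed
  qed
  have p_le: "p f \<le> l q" if "f \<in> poly_bounded" "q \<in> U f" for f q
    unfolding p_def using bdd[OF that(1)] that(2) by (intro cINF_lower)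
  have "sublinear_on poly_bounded p"
    unfolding sublinear_on_def
  proof (intro conjI ballI allI impI)
    fix f g :: "real^'n \<Rightarrow> real" assume fg: "f \<in> poly_bounded" "g \<in> poly_bounded"
    note fg_sum = function_space_add[OF function_space_poly_bounded fg]
    have *: "p (\<lambda>x. f x + g x) \<le> l q + l r" if "q \<in> U f" "r \<in> U g" for q r
    proof -
      have "q + r \<in> U (\<lambda>x. f x + g x)"
        using that by (auto simp: U_def poly_eval_add intro: add_mono)
      then show ?thesis using p_le[OF fg_sum] l by (metis linear_add)
    qed
    have "p (\<lambda>x. f x + g x) - l r \<le> p f" if "r \<in> U g" for r
      unfolding p_def[of f] using U_nonempty[OF fg(1)] *[OF _ that]
      by (intro cINF_greatest) (auto simp: algebra_simps)
    then have "p (\<lambda>x. f x + g x) - p f \<le> p g"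
      unfolding p_def[of g] using U_nonempty[OF fg(2)]
      by (intro cINF_greatest) (auto simp: algebra_simps)
    then show "p (\<lambda>x. f x + g x) \<le> p f + p g" by linarith
  next
    fix f :: "real^'n \<Rightarrow> real" and c :: real assume f: "f \<in> poly_bounded" and c: "0 < c"
    note cf = function_space_scale[OF function_space_poly_bounded f, of c]
    have "p (\<lambda>x. c * f x) / c \<le> l q" if "q \<in> U f" for q
    proof -
      have "c *\<^sub>R q \<in> U (\<lambda>x. c * f x)"
        using that c by (auto simp: U_def poly_eval_scaleR)
      then have "p (\<lambda>x. c * f x) \<le> c * l q"
        using p_le[OF cf] linear_scale[OF l, of c q] by fastforce
      then show ?thesis using c by (simp add: field_simps)
    qed
    then have "p (\<lambda>x. c * f x) / c \<le> p f"
      unfolding p_def[of f] using U_nonempty[OF f] by (intro cINF_greatest) auto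
    then show "p (\<lambda>x. c * f x) \<le> c * p f" using c by (simp add: field_simps)
  qed
  then obtain L where L: "linear_functional_on poly_bounded L"
    and L_le: "\<And>f. f \<in> poly_bounded \<Longrightarrow> L f \<le> p f"
    using linear_minorant_exists[OF function_space_poly_bounded] by blast
  have le: "L f \<le> l q" if "f \<in> poly_bounded" "\<And>x. x \<in> K \<Longrightarrow> f x \<le> poly_eval q x" for f q
  proof -
    have "q \<in> U f" using that(2) by (simp add: U_def)
    then show ?thesis using L_le[OF that(1)] p_le[OF that(1)] by fastforce
  qed
  show thesis
  proof (rule that[OF L])
    show "positive_functional_on poly_bounded K L"
      unfolding positive_functional_on_def
    proof (intro ballI impI)
      fix f :: "real^'n \<Rightarrow> real" assume f: "f \<in> poly_bounded" and pos: "\<forall>x\<in>K. 0 \<le> f x"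
      have "L (\<lambda>x. - 1 * f x) \<le> l 0"
        using pos by (intro le function_space_scale[OF function_space_poly_bounded f]) auto
      then show "0 \<le> L f"
        using linear_functional_on_scale[OF L f, of "- 1"] linear_0[OF l] by simp
    qed
    fix q :: "'n mpoly"
    have "L (\<lambda>x. - 1 * poly_eval q x) \<le> l ((- 1) *\<^sub>R q)"
      using function_space_scale[OF function_space_poly_bounded poly_eval_in_poly_bounded, of "-1" q]
      by (intro le) (simp_all add: poly_eval_scaleR del: scaleR_minus_left scaleR_minus1_left)
    then have "l q \<le> L (poly_eval q)"
      using linear_functional_on_scale[OF L poly_eval_in_poly_bounded, of "- 1"] l
      by (simp add: linear_neg)
    then show "L (poly_eval q) = l q"
      using le[OF poly_eval_in_poly_bounded, of q q] by simp
  qed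
qed

section \<open>Haviland's theorem\<close>

definition cutoff :: "nat \<Rightarrow> 'a::real_normed_vector \<Rightarrow> real" where
  "cutoff N x = max 0 (min 1 (real N - norm x))"

lemma cutoff_nonneg: "0 \<le> cutoff N x" and cutoff_le_1: "cutoff N x \<le> 1"
  by (simp_all add: cutoff_def)

lemma cutoff_eq_0: "real N < norm x \<Longrightarrow> cutoff N x = 0"
  by (simp add: cutoff_def)

lemma cutoff_mono: "m \<le> n \<Longrightarrow> cutoff m x \<le> cutoff n x"
  by (auto simp: cutoff_def min_def max_def)

lemma cutoff_tendsto: "(\<lambda>N. cutoff N x) \<longlonglongrightarrow> 1"
proof (rule tendsto_eventually)
  obtain n where "norm x + 1 \<le> real n" using real_arch_simple by blast
  then show "\<forall>\<^sub>F N in sequentially. cutoff N x = 1"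
    by (intro eventually_sequentiallyI[of n]) (auto simp: cutoff_def)
qed

lemma continuous_on_cutoff: "continuous_on S (cutoff N)"
  unfolding cutoff_def by (intro continuous_intros)

text \<open>The left side vanishes for \<open>norm x \<le> N\<close> and is at most 1 elsewhere. The summand 1 on
  the right makes the bound valid also for \<open>N = 0\<close>.\<close>

lemma one_minus_cutoff_le: "1 - cutoff (Suc N) x \<le> ((norm x)\<^sup>2 + 1) / (real N + 1)"
proof (cases "norm x \<le> real N")
  case True
  then have "cutoff (Suc N) x = 1" by (simp add: cutoff_def)
  then show ?thesis by simp
next
  case False
  have "real N * 1 \<le> real N * real N" by (cases N) (simp_all del: of_nat_Suc)
  also have "\<dots> \<le> norm x * norm x" using False by (intro mult_mono) auto
  finally have "1 \<le> ((norm x)\<^sup>2 + 1) / (real N + 1)" by (simp add: power2_eq_square)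
  then show ?thesis using cutoff_nonneg[of "Suc N" x] by linarith
qed

text \<open>The measure represents \<open>L\<close> on compactly supported functions. A nonnegative polynomial \<open>q\<close> is
  the increasing limit of its cutoffs, and the values of \<open>L\<close> on the cutoffs converge to \<open>l q\<close>, because
  the part of \<open>q\<close> outside a large ball is dominated by a small multiple of another polynomial.\<close>

lemma haviland:
  fixes l :: "'n::finite mpoly \<Rightarrow> real"
  assumes K: "closed K" and l: "linear l" and psd: "\<And>q. q \<in> Psd K \<Longrightarrow> 0 \<le> l q"
  shows "\<exists>\<mu>. represented_by_measure_on K l \<mu>"
proof -
  obtain L where L: "linear_functional_on poly_bounded L" and pos: "positive_functional_on poly_bounded K L"
    and Ll: "\<And>q. L (poly_eval q) = l q"
    using psd_functional_extension[OF l psd] by blast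
  note V = function_space_poly_bounded
  obtain \<mu> where sets: "sets \<mu> = sets (restrict_space borel K)" and fin: "finite_measure \<mu>"
    and int: "\<And>f R. continuous_on UNIV f \<Longrightarrow> (\<And>x. R < norm x \<Longrightarrow> f x = 0) \<Longrightarrow>
        integrable \<mu> f \<and> (\<integral>x. f x \<partial>\<mu>) = L f"
    using riesz_representation_bounded[OF K V bounded_in_poly_bounded L pos] by blast
  obtain s :: "'n mpoly" where s: "\<And>x. poly_eval s x = (norm x)\<^sup>2 + 1"
    using poly_eval_norm_sq_plus_1 by blast
  have meas: "poly_eval q \<in> borel_measurable \<mu>" for q :: "'n mpoly"
    unfolding measurable_cong_sets[OF sets refl]
    by (intro measurable_restrict_space1 borel_measurable_continuous_onI continuous_on_poly_eval)
  have sq: "integrable \<mu> (poly_eval q) \<and> (\<integral>x. poly_eval q x \<partial>\<mu>) = l q"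
    if nn: "\<And>x. 0 \<le> poly_eval q x" for q
  proof -
    define f where "f N x = cutoff N x * poly_eval q x" for N x
    have f_cont: "continuous_on UNIV (f N)" for N
      unfolding f_def by (intro continuous_intros continuous_on_cutoff continuous_on_poly_eval)
    have f_int: "integrable \<mu> (f N)" "(\<integral>x. f N x \<partial>\<mu>) = L (f N)" for N
      using int[OF f_cont, of N N] by (auto simp: f_def cutoff_eq_0)
    have f_le: "f N x \<le> poly_eval q x" and f_nonneg: "0 \<le> f N x" for N x
      using nn[of x] cutoff_nonneg[of N x] cutoff_le_1[of N x] by (auto simp: f_def mult_left_le_one_le)
    have fV: "f N \<in> poly_bounded" for N
      using f_le f_nonneg by (auto simp: poly_bounded_def)
    have upper: "L (f N) \<le> l q" for N
      using linear_functional_on_mono[OF V L pos fV poly_eval_in_poly_bounded f_le] by (simp add: Ll)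
    have lower: "l q - l (s * q) / (real N + 1) \<le> L (f (Suc N))" for N
    proof -
      let ?r = "q + (- (1 / (real N + 1))) *\<^sub>R (s * q)"
      have "poly_eval ?r x \<le> f (Suc N) x" for x
      proof -
        have "(1 - cutoff (Suc N) x) * poly_eval q x \<le> ((norm x)\<^sup>2 + 1) / (real N + 1) * poly_eval q x"
          by (intro mult_right_mono one_minus_cutoff_le nn)
        then show ?thesis
          unfolding poly_eval_add poly_eval_scaleR poly_eval_mult s f_def by (simp add: algebra_simps add_divide_distrib)
      qed
      then have "L (poly_eval ?r) \<le> L (f (Suc N))"
        by (intro linear_functional_on_mono[OF V L pos poly_eval_in_poly_bounded fV])
      then show ?thesis
        unfolding Ll linear_add[OF l] linear_scale[OF l] by simp
    qed
    have lim: "(\<lambda>N. L (f (Suc N))) \<longlonglongrightarrow> l q"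
    proof (rule tendsto_sandwich[OF always_eventually always_eventually])
      show "\<forall>N. l q - l (s * q) / (real N + 1) \<le> L (f (Suc N))" using lower by blast
      show "\<forall>N. L (f (Suc N)) \<le> l q" using upper by blast
      have "(\<lambda>N. l q - l (s * q) * inverse (real (Suc N))) \<longlonglongrightarrow> l q - l (s * q) * 0"
        by (intro tendsto_intros LIMSEQ_inverse_real_of_nat)
      then show "(\<lambda>N. l q - l (s * q) / (real N + 1)) \<longlonglongrightarrow> l q"
        by (simp add: divide_inverse add.commute)
    qed simp
    have incr: "AE x in \<mu>. incseq (\<lambda>N. f (Suc N) x)"
      by (auto simp: incseq_def f_def intro!: mult_right_mono cutoff_mono nn)
    have conv: "AE x in \<mu>. (\<lambda>N. f (Suc N) x) \<longlonglongrightarrow> poly_eval q x"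
    proof (rule AE_I2)
      fix x
      have "(\<lambda>N. cutoff (Suc N) x * poly_eval q x) \<longlonglongrightarrow> 1 * poly_eval q x"
        by (intro tendsto_mult LIMSEQ_Suc[OF cutoff_tendsto] tendsto_const)
      then show "(\<lambda>N. f (Suc N) x) \<longlonglongrightarrow> poly_eval q x" by (simp add: f_def)
    qed
    have "integrable \<mu> (poly_eval q)" "integral\<^sup>L \<mu> (poly_eval q) = l q"
      using integrable_monotone_convergence[OF f_int(1) incr conv _ meas, of "l q"]
        integral_monotone_convergence[OF f_int(1) incr conv _ meas, of "l q"] lim
      by (simp_all add: f_int(2))
    then show ?thesis by simp
  qed
  have "integrable \<mu> (poly_eval q) \<and> l q = (\<integral>x. poly_eval q x \<partial>\<mu>)" for q
  proof -
    \<comment> \<open>Write \<open>q\<close> as the difference of the nonnegative polynomials \<open>q\<^sup>2 + q + 1\<close> and \<open>q\<^sup>2 + 1\<close>.\<close>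
    let ?p = "q * q + q + 1" and ?r = "q * q + 1"
    have p: "0 \<le> poly_eval ?p x" and r: "0 \<le> poly_eval ?r x" for x
    proof -
      have "0 \<le> (poly_eval q x + 1 / 2)\<^sup>2" by simp
      then show "0 \<le> poly_eval ?p x"
        unfolding poly_eval_add poly_eval_mult poly_eval_one by (simp add: power2_eq_square algebra_simps)
      show "0 \<le> poly_eval ?r x"
        unfolding poly_eval_add poly_eval_mult poly_eval_one by simp
    qed
    have q: "poly_eval q = (\<lambda>x. poly_eval ?p x - poly_eval ?r x)"
      by (rule ext) (simp add: poly_eval_add)
    have "l q = l ?p - l ?r" by (simp add: linear_add[OF l])
    then show ?thesis
      using sq[OF p] sq[OF r] by (subst (1 3) q) simp
  qed
  then show ?thesis using sets unfolding represented_by_measure_on_def by blast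
qed

section \<open>Equivalence of the three conditions\<close>

theorem proposition3p1:
  fixes \<tau> :: "'n::finite mpoly topology"
    and K :: "(real^'n) set"
    and C :: "'n mpoly set"
  assumes "locally_convex_topology \<tau>"
    and "closed K"
    and "is_cone C"
  shows "(dual_cone \<tau> C \<subseteq> dual_cone \<tau> (Psd K) \<longleftrightarrow> Psd K \<subseteq> bidual_cone \<tau> C) \<and>
         (Psd K \<subseteq> bidual_cone \<tau> C \<longleftrightarrow>
            (\<forall>l \<in> dual_cone \<tau> C. \<exists>\<mu>. represented_by_measure_on K l \<mu>))"
proof -
  have pairing: "dual_cone \<tau> C \<subseteq> dual_cone \<tau> (Psd K) \<longleftrightarrow> Psd K \<subseteq> bidual_cone \<tau> C"
    unfolding dual_cone_def bidual_cone_def by blast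
  have "(\<exists>\<mu>. represented_by_measure_on K l \<mu>) \<longleftrightarrow> l \<in> dual_cone \<tau> (Psd K)"
    if l: "l \<in> dual_cone \<tau> C" for l
  proof
    assume "\<exists>\<mu>. represented_by_measure_on K l \<mu>"
    then obtain \<mu> where \<mu>: "represented_by_measure_on K l \<mu>" ..
    then have space: "space \<mu> = K"
      using sets_eq_imp_space_eq[of \<mu> "restrict_space borel K"]
      by (simp add: represented_by_measure_on_def space_restrict_space)
    have "0 \<le> l f" if "f \<in> Psd K" for f
    proof -
      have "0 \<le> (\<integral>x. poly_eval f x \<partial>\<mu>)"
        using that by (intro Bochner_Integration.integral_nonneg) (simp add: Psd_def space)
      then show ?thesis using \<mu> by (simp add: represented_by_measure_on_def)
    qed
    then show "l \<in> dual_cone \<tau> (Psd K)" using l by (simp add: dual_cone_def)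
  next
    assume "l \<in> dual_cone \<tau> (Psd K)"
    then show "\<exists>\<mu>. represented_by_measure_on K l \<mu>"
      using assms(2) by (intro haviland) (auto simp: dual_cone_def cont_dual_def)
  qed
  then show ?thesis using pairing by blast
qed

end
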